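(* Let $D$ be an $(N,3^n)$-design, let $\bar\phi(D)$ be the average centered $L_2$-discrepancy over all $(3!)^n$ level permutations of $D$, and let $(A_1(D),\ldots,A_n(D))$ be the (generalized) word-length pattern of $D$. Then $$\bar{\phi}(D)=\left(\frac{13}{12}\right)^n-\left(\frac{29}{27}\right)^n+\left(\frac{29}{27}\right)^n\sum_{i=1}^n\left(\frac{2}{29}\right)^{i}A_i(D).$$
   Context: An $(N,s^n)$-design is an $N\times n$ matrix $D=(x_{ik})$ with entries in $\{0,1,\ldots,s-1\}$ (rows are runs and may repeat; columns are factors). Here $s=3$. Centered $L_2$-discrepancy: with $u_{ik}=(2x_{ik}+1)/(2s)$, $$\phi(D)=\frac{1}{N^2}\sum_{i=1}^{N}\sum_{j=1}^{N}\prod_{k=1}^n\left(1+\tfrac12\left|u_{ik}-\tfrac12\right|+\tfrac12\left|u_{jk}-\tfrac12\right|-\tfrac12|u_{ik}-u_{jk}|\right)-\frac{2}{N}\sum_{i=1}^{N}\prod_{k=1}^n\left(1+\tfrac12\left|u_{ik}-\tfrac12\right|-\tfrac12\left|u_{ik}-\tfrac12\right|^2\right)+\left(\frac{13}{12}\right)^n.$$ Level permutations: for each $n$-tuple $(\pi_1,\ldots,\pi_n)$ of permutations of $\{0,\ldots,s-1\}$, the permuted design is $(\pi_k(x_{ik}))$. $\mathcal P(D)$ denotes the family (counted with multiplicity) of all $(s!)^n$ designs so obtained, and $$\bar\phi(D)=\frac{1}{(s!)^n}\sum_{D'\in\mathcal P(D)}\phi(D').$$ (Generalized) word-length pattern: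 fix functions $\chi_0\equiv 1,\chi_1,\ldots,\chi_{s-1}$ on $\{0,\ldots,s-1\}$ with $\frac1s\sum_{x=0}^{s-1}\chi_u(x)\overline{\chi_v(x)}=\delta_{uv}$ (orthonormal contrasts). For $j=0,\ldots,n$, $$A_j(D)=N^{-2}\sum_{u}\left|\sum_{i=1}^N\prod_{k=1}^n\chi_{u_k}(x_{ik})\right|^2,$$ where $u=(u_1,\ldots,u_n)$ ranges over the vectors in $\{0,\ldots,s-1\}^n$ with exactly $j$ nonzero coordinates. The value does not depend on the choice of the orthonormal contrasts. *)

theory Defs
  imports
    "Jordan_Normal_Form.Matrix"
    "HOL-Combinatorics.Permutations"
    "HOL-Library.FuncSet"
begin

text \<open>
  Designs are matrices over \<open>nat\<close>; rows (runs), columns (factors) and levels are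
  numbered from 0. A design has at least one run, since the discrepancy and the
  word-length pattern divide by \<open>N\<close>.
\<close>

definition design :: "nat \<Rightarrow> nat \<Rightarrow> nat \<Rightarrow> nat mat \<Rightarrow> bool" where
  "design N s n D \<longleftrightarrow>
     0 < N \<and> D \<in> carrier_mat N n \<and> (\<forall>i<N. \<forall>k<n. D $$ (i, k) \<in> {0..<s})"

definition scaled_level :: "nat \<Rightarrow> nat \<Rightarrow> real" where
  "scaled_level s x = (2 * real x + 1) / (2 * real s)"

definition centered_L2 :: "nat \<Rightarrow> nat mat \<Rightarrow> real" where
  "centered_L2 s D =
     (let N = dim_row D; n = dim_col D; u = (\<lambda>i k. scaled_level s (D $$ (i, k))) in
       1 / (real N)^2 *
         (\<Sum>i<N. \<Sum>j<N. \<Prod>k<n.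
            1 + 1/2 * \<bar>u i k - 1/2\<bar> + 1/2 * \<bar>u j k - 1/2\<bar> - 1/2 * \<bar>u i k - u j k\<bar>)
       - 2 / real N *
         (\<Sum>i<N. \<Prod>k<n. 1 + 1/2 * \<bar>u i k - 1/2\<bar> - 1/2 * \<bar>u i k - 1/2\<bar>^2)
       + (13/12)^n)"

definition level_perms :: "nat \<Rightarrow> nat \<Rightarrow> (nat \<Rightarrow> nat \<Rightarrow> nat) set" where
  "level_perms s n = {0..<n} \<rightarrow>\<^sub>E {p. p permutes {0..<s}}"

definition permute_levels :: "(nat \<Rightarrow> nat \<Rightarrow> nat) \<Rightarrow> nat mat \<Rightarrow> nat mat" where
  "permute_levels \<pi> D = mat (dim_row D) (dim_col D) (\<lambda>(i, k). \<pi> k (D $$ (i, k)))"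

text \<open>
  The sum ranges over the tuples of permutations, not over the set of resulting designs,
  so that coinciding permuted designs are counted with multiplicity.
\<close>

definition avg_centered_L2 :: "nat \<Rightarrow> nat mat \<Rightarrow> real" where
  "avg_centered_L2 s D =
     1 / (fact s)^(dim_col D) *
       (\<Sum>\<pi>\<in>level_perms s (dim_col D). centered_L2 s (permute_levels \<pi> D))"

text \<open>\<open>\<chi> u x\<close> is the value of the contrast \<open>\<chi>\<^sub>u\<close> at level \<open>x\<close>; values outside \<open>{0..<s}\<close> are irrelevant.\<close>

definition orthonormal_contrasts :: "nat \<Rightarrow> (nat \<Rightarrow> nat \<Rightarrow> complex) \<Rightarrow> bool" where
  "orthonormal_contrasts s \<chi> \<longleftrightarrow>
     (\<forall>x\<in>{0..<s}. \<chi> 0 x = 1) \<and>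
     (\<forall>u\<in>{0..<s}. \<forall>v\<in>{0..<s}.
        1 / of_nat s * (\<Sum>x=0..<s. \<chi> u x * cnj (\<chi> v x)) = (if u = v then 1 else 0))"

definition word_length_pattern ::
    "nat \<Rightarrow> (nat \<Rightarrow> nat \<Rightarrow> complex) \<Rightarrow> nat mat \<Rightarrow> nat \<Rightarrow> real" where
  "word_length_pattern s \<chi> D j =
     (let N = dim_row D; n = dim_col D in
       1 / (real N)^2 *
         (\<Sum>u | u \<in> {0..<n} \<rightarrow>\<^sub>E {0..<s} \<and> card {k \<in> {0..<n}. u k \<noteq> 0} = j.
            (cmod (\<Sum>i<N. \<Prod>k<n. \<chi> (u k) (D $$ (i, k))))^2))"

end

theory Submission
  imports Defs "Jordan_Normal_Form.Determinant"
begin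

text \<open>
  The discrepancy is built from two sums of products over the factors: one over pairs of runs and
  one over single runs.  Averaging over independent level permutations of the factors turns the
  average of each product into the product of the one-factor averages
  (\<open>avg_centered_L2_eq_kernel_averages\<close>).

  With three levels the scaled levels are \<open>1/6\<close>, \<open>1/2\<close>, \<open>5/6\<close>, and the pair kernel equals \<open>1\<close> at any
  two distinct levels, while on the diagonal it takes the values \<open>4/3\<close>, \<open>1\<close>, \<open>4/3\<close>, with mean \<open>11/9\<close>.
  The single-run kernel takes the values \<open>10/9\<close>, \<open>1\<close>, \<open>10/9\<close>, with mean \<open>29/27\<close>.  So
  the average discrepancy depends on \<open>D\<close> only through the number of factors in which two
  runs coincide: each coincidence contributes the factor \<open>11/9\<close> to the pair sum.

  The word-length pattern carries the same information.  A square matrix with orthonormal rows also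
  has orthonormal columns, so \<open>\<Sum>\<^sub>u \<chi>\<^sub>u(x) cnj (\<chi>\<^sub>u(y))\<close> is \<open>s\<close> or \<open>0\<close> according to
  whether \<open>x = y\<close>.  Expanding the squared modulus then shows that \<open>\<Sum>\<^sub>j t\<^sup>j A\<^sub>j(D)\<close> is the mean, over pairs
  of runs, of a product having a factor \<open>1 + (s - 1) t\<close> for each coincidence and \<open>1 - t\<close> for
  each disagreement (\<open>word_length_enumerator\<close>).  At \<open>s = 3\<close> and \<open>t = 2/29\<close> these are
  \<open>33/29\<close> and \<open>27/29\<close>; multiplied by \<open>29/27\<close> they become \<open>11/9\<close> and \<open>1\<close>, exactly the averages of the
  pair kernel.  The single-run term \<open>-2 (29/27)\<^sup>n\<close> and the term of \<open>A\<^sub>0(D) = 1\<close> combine to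
  \<open>-(29/27)\<^sup>n\<close>.
\<close>

section \<open>Contrasts and the word-length enumerator\<close>

text \<open>
  Orthonormality says that the matrix of the \<open>\<chi> u x\<close> times its scaled conjugate transpose is the
  identity.  A one-sided inverse of a square matrix is two-sided, and the product in
  the other order is the asserted relation.
\<close>

lemma orthonormal_contrasts_dual:
  assumes \<chi>: "orthonormal_contrasts s \<chi>" and x: "x < s" and y: "y < s"
  shows "(\<Sum>u<s. \<chi> u x * cnj (\<chi> u y)) = (if x = y then of_nat s else 0)"
proof -
  define A where "A = mat s s (\<lambda>(u, x). \<chi> u x)"
  define B where "B = mat s s (\<lambda>(x, v). cnj (\<chi> v x) / of_nat s)"
  have A: "A \<in> carrier_mat s s" and B: "B \<in> carrier_mat s s"
    by (simp_all add: A_def B_def)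
  have "A * B = 1\<^sub>m s"
  proof (rule eq_matI)
    fix u v assume "u < dim_row (1\<^sub>m s)" "v < dim_col (1\<^sub>m s)"
    then have u: "u < s" and v: "v < s" by simp_all
    have "(A * B) $$ (u, v) = (\<Sum>x=0..<s. \<chi> u x * (cnj (\<chi> v x) / of_nat s))"
      using u v by (simp add: A_def B_def scalar_prod_def)
    also have "\<dots> = 1 / of_nat s * (\<Sum>x=0..<s. \<chi> u x * cnj (\<chi> v x))"
      by (simp add: sum_distrib_left)
    also have "\<dots> = (if u = v then 1 else 0)"
      using \<chi> u v by (auto simp: orthonormal_contrasts_def)
    finally show "(A * B) $$ (u, v) = 1\<^sub>m s $$ (u, v)" using u v by simp
  qed (simp_all add: A_def B_def)
  then have "B * A = 1\<^sub>m s"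
    by (rule mat_mult_left_right_inverse[OF A B])
  then have "(B * A) $$ (y, x) = (if x = y then 1 else 0)"
    using x y by auto
  moreover have "(B * A) $$ (y, x) = (\<Sum>u<s. cnj (\<chi> u y) / of_nat s * \<chi> u x)"
    using x y by (simp add: A_def B_def scalar_prod_def lessThan_atLeast0)
  moreover have "\<dots> = (\<Sum>u<s. \<chi> u x * cnj (\<chi> u y)) / of_nat s"
    by (simp add: sum_divide_distrib mult.commute)
  ultimately show ?thesis using x by (auto simp: field_simps split: if_splits)
qed

text \<open>
  The contrast \<open>\<chi> 0\<close> contributes \<open>1\<close>, so the remaining contrasts contribute
  \<open>s - 1\<close> or \<open>-1\<close>.
\<close>

lemma weighted_contrast_sum:
  fixes t :: real
  assumes \<chi>: "orthonormal_contrasts s \<chi>" and x: "x < s" and y: "y < s"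
  shows "(\<Sum>u\<in>{0..<s}. (if u = 0 then 1 else of_real t) * (\<chi> u x * cnj (\<chi> u y)))
    = of_real (if x = y then 1 + (real s - 1) * t else 1 - t)"
proof -
  have one: "\<chi> 0 x * cnj (\<chi> 0 y) = 1"
    using \<chi> x y by (simp add: orthonormal_contrasts_def)
  have "(\<Sum>u\<in>{0..<s}. (if u = 0 then 1 else of_real t) * (\<chi> u x * cnj (\<chi> u y)))
     = (\<Sum>u<s. of_real t * (\<chi> u x * cnj (\<chi> u y)) + (if u = 0 then 1 - of_real t else 0))"
    unfolding lessThan_atLeast0
  proof (rule sum.cong[OF refl])
    fix u
    show "(if u = 0 then 1 else of_real t) * (\<chi> u x * cnj (\<chi> u y))
      = of_real t * (\<chi> u x * cnj (\<chi> u y)) + (if u = 0 then 1 - of_real t else 0)"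
      using one by (cases "u = 0") simp_all
  qed
  also have "\<dots> = of_real t * (\<Sum>u<s. \<chi> u x * cnj (\<chi> u y)) + (1 - of_real t)"
    using x by (simp add: sum.distrib sum_distrib_left)
  also have "\<dots> = of_real (if x = y then 1 + (real s - 1) * t else 1 - t)"
    using orthonormal_contrasts_dual[OF assms] by (simp add: algebra_simps)
  finally show ?thesis .
qed

text \<open>
  Grouping the index vectors by their number of nonzero coordinates, the powers of \<open>t\<close>
  split into one weight per factor; the sum over all index vectors then factorizes.
\<close>

lemma word_length_enumerator:
  fixes t :: real
  assumes D: "design N s n D" and \<chi>: "orthonormal_contrasts s \<chi>"
  shows "(\<Sum>j\<le>n. t^j * word_length_pattern s \<chi> D j)
    = 1 / (real N)^2 * (\<Sum>i<N. \<Sum>j<N. \<Prod>k<n.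
        if D $$ (i, k) = D $$ (j, k) then 1 + (real s - 1) * t else 1 - t)"
proof -
  define U where "U = {0..<n} \<rightarrow>\<^sub>E {0..<s}"
  define w where "w = (\<lambda>u :: nat \<Rightarrow> nat. card {k \<in> {0..<n}. u k \<noteq> 0})"
  define c where "c = (\<lambda>u. \<Sum>i<N. \<Prod>k<n. \<chi> (u k) (D $$ (i, k)))"
  have dims: "dim_row D = N" "dim_col D = n"
    and lev: "\<And>i k. i < N \<Longrightarrow> k < n \<Longrightarrow> D $$ (i, k) < s"
    using D by (auto simp: design_def)
  have finU: "finite U" unfolding U_def by (intro finite_PiE) auto
  have w_le: "w u \<le> n" for u
  proof -
    have "w u \<le> card {0..<n}" unfolding w_def by (rule card_mono) auto
    then show ?thesis by simp
  qed
  have wlp: "word_length_pattern s \<chi> D j = 1 / (real N)^2 * (\<Sum>u | u \<in> U \<and> w u = j. (cmod (c u))^2)"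
    for j
    by (simp add: word_length_pattern_def Let_def dims U_def w_def c_def)
  have "(\<Sum>j\<le>n. t^j * word_length_pattern s \<chi> D j)
      = 1 / (real N)^2 * (\<Sum>j\<le>n. \<Sum>u | u \<in> U \<and> w u = j. t^w u * (cmod (c u))^2)"
    unfolding wlp sum_distrib_left by (intro sum.cong refl) auto
  also have "(\<Sum>j\<le>n. \<Sum>u | u \<in> U \<and> w u = j. t^w u * (cmod (c u))^2) = (\<Sum>u\<in>U. t^w u * (cmod (c u))^2)"
    using sum.group[OF finU finite_atMost[of n], of w "\<lambda>u. t^w u * (cmod (c u))^2"] w_le
    by (auto simp: image_subset_iff)
  also have "\<dots> = (\<Sum>i<N. \<Sum>j<N. \<Prod>k<n.
        if D $$ (i, k) = D $$ (j, k) then 1 + (real s - 1) * t else 1 - t)"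
  proof -
    have tw: "t^w u = (\<Prod>k<n. if u k = 0 then 1 else t)" for u
      by (simp add: w_def prod.If_cases lessThan_atLeast0 Int_def Collect_neg_eq[symmetric])
    have expand: "of_real (t^w u * (cmod (c u))^2)
        = (\<Sum>i<N. \<Sum>j<N. \<Prod>k\<in>{0..<n}. (if u k = 0 then 1 else of_real t) *
             (\<chi> (u k) (D $$ (i, k)) * cnj (\<chi> (u k) (D $$ (j, k)))))" for u
    proof -
      have "of_real (t^w u * (cmod (c u))^2) = of_real (t^w u) * (c u * cnj (c u))"
        by (simp only: of_real_mult complex_norm_square)
      also have "c u * cnj (c u) = (\<Sum>i<N. \<Sum>j<N. (\<Prod>k<n. \<chi> (u k) (D $$ (i, k))) *
             (\<Prod>k<n. cnj (\<chi> (u k) (D $$ (j, k)))))"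
        by (simp add: c_def sum_product)
      also have "of_real (t^w u) = (\<Prod>k<n. if u k = 0 then 1 else (of_real t :: complex))"
        unfolding tw of_real_prod by (rule prod.cong) auto
      finally show ?thesis
        by (simp add: sum_distrib_left prod.distrib lessThan_atLeast0)
    qed
    have "complex_of_real (\<Sum>u\<in>U. t^w u * (cmod (c u))^2)
      = (\<Sum>u\<in>U. \<Sum>i<N. \<Sum>j<N. \<Prod>k\<in>{0..<n}. (if u k = 0 then 1 else of_real t) *
             (\<chi> (u k) (D $$ (i, k)) * cnj (\<chi> (u k) (D $$ (j, k)))))"
      unfolding of_real_sum expand ..
    also have "\<dots> = (\<Sum>i<N. \<Sum>j<N. \<Sum>u\<in>U. \<Prod>k\<in>{0..<n}. (if u k = 0 then 1 else of_real t) *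
             (\<chi> (u k) (D $$ (i, k)) * cnj (\<chi> (u k) (D $$ (j, k)))))"
      by (subst sum.swap, rule sum.cong[OF refl], rule sum.swap)
    also have "\<dots> = (\<Sum>i<N. \<Sum>j<N. \<Prod>k\<in>{0..<n}. \<Sum>v\<in>{0..<s}. (if v = 0 then 1 else of_real t) *
             (\<chi> v (D $$ (i, k)) * cnj (\<chi> v (D $$ (j, k)))))"
      unfolding U_def by (subst prod_sum_PiE) auto
    also have "\<dots> = (\<Sum>i<N. \<Sum>j<N. \<Prod>k\<in>{0..<n}.
        of_real (if D $$ (i, k) = D $$ (j, k) then 1 + (real s - 1) * t else 1 - t))"
      by (intro sum.cong prod.cong refl weighted_contrast_sum[OF \<chi>]) (auto intro: lev)
    also have "\<dots> = of_real (\<Sum>i<N. \<Sum>j<N. \<Prod>k<n.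
        if D $$ (i, k) = D $$ (j, k) then 1 + (real s - 1) * t else 1 - t)"
      by (simp only: of_real_sum of_real_prod lessThan_atLeast0)
    finally show ?thesis by (simp only: of_real_eq_iff)
  qed
  finally show ?thesis .
qed

text \<open>The only index vector of weight \<open>0\<close> is the zero vector, and \<open>\<chi> 0\<close> is constantly \<open>1\<close>.\<close>

lemma word_length_pattern_0:
  assumes D: "design N s n D" and \<chi>: "orthonormal_contrasts s \<chi>" and s: "0 < s"
  shows "word_length_pattern s \<chi> D 0 = 1"
proof -
  have dims: "dim_row D = N" "dim_col D = n" and N: "0 < N"
    and lev: "\<And>i k. i < N \<Longrightarrow> k < n \<Longrightarrow> D $$ (i, k) < s"
    using D by (auto simp: design_def)
  have index: "{u. u \<in> {0..<n} \<rightarrow>\<^sub>E {0..<s} \<and> card {k \<in> {0..<n}. u k \<noteq> 0} = 0}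
      = {\<lambda>k\<in>{0..<n}. 0}"
  proof (intro equalityI subsetI)
    fix u assume "u \<in> {u. u \<in> {0..<n} \<rightarrow>\<^sub>E {0..<s} \<and> card {k \<in> {0..<n}. u k \<noteq> 0} = 0}"
    then have u: "u \<in> {0..<n} \<rightarrow>\<^sub>E {0..<s}" and "\<forall>k<n. u k = 0" by auto
    then show "u \<in> {\<lambda>k\<in>{0..<n}. 0}" by (auto simp: fun_eq_iff PiE_def extensional_def)
  qed (use s in auto)
  have "\<chi> 0 (D $$ (i, k)) = 1" if "i < N" "k < n" for i k
    using \<chi> lev[OF that] by (simp add: orthonormal_contrasts_def)
  then have "(\<Sum>i<N. \<Prod>k<n. \<chi> ((\<lambda>k\<in>{0..<n}. 0) k) (D $$ (i, k))) = of_nat N"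
    by simp
  then show ?thesis
    using N by (simp only: word_length_pattern_def Let_def dims index) simp
qed

section \<open>Averaging over level permutations\<close>

definition pair_kernel :: "nat \<Rightarrow> nat \<Rightarrow> nat \<Rightarrow> real" where
  "pair_kernel s x y = 1 + 1/2 * \<bar>scaled_level s x - 1/2\<bar> + 1/2 * \<bar>scaled_level s y - 1/2\<bar>
     - 1/2 * \<bar>scaled_level s x - scaled_level s y\<bar>"

definition run_kernel :: "nat \<Rightarrow> nat \<Rightarrow> real" where
  "run_kernel s x = 1 + 1/2 * \<bar>scaled_level s x - 1/2\<bar> - 1/2 * \<bar>scaled_level s x - 1/2\<bar>^2"

definition perm_average :: "nat \<Rightarrow> ((nat \<Rightarrow> nat) \<Rightarrow> real) \<Rightarrow> real" where
  "perm_average s f = (\<Sum>p | p permutes {0..<s}. f p) / fact s"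

text \<open>The permutations of different factors are chosen independently.\<close>

lemma average_prod_level_perms:
  "(\<Sum>\<pi>\<in>level_perms s n. \<Prod>k<n. f k (\<pi> k)) / (fact s)^n = (\<Prod>k<n. perm_average s (f k))"
proof -
  have "(\<Sum>\<pi>\<in>level_perms s n. \<Prod>k<n. f k (\<pi> k)) = (\<Prod>k<n. \<Sum>p | p permutes {0..<s}. f k p)"
    unfolding level_perms_def lessThan_atLeast0
    by (subst prod_sum_PiE) (auto intro: finite_permutations)
  then show ?thesis
    by (simp add: perm_average_def prod_dividef)
qed

lemma card_level_perms: "card (level_perms s n) = fact s ^ n"
  by (simp add: level_perms_def card_PiE card_permutations)

lemma avg_centered_L2_eq_kernel_averages:
  assumes D: "D \<in> carrier_mat N n"
  shows "avg_centered_L2 s D =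
    1 / (real N)^2 * (\<Sum>i<N. \<Sum>j<N. \<Prod>k<n.
        perm_average s (\<lambda>p. pair_kernel s (p (D $$ (i, k))) (p (D $$ (j, k)))))
    - 2 / real N * (\<Sum>i<N. \<Prod>k<n. perm_average s (\<lambda>p. run_kernel s (p (D $$ (i, k)))))
    + (13/12)^n"
proof -
  define L where "L = level_perms s n"
  define F where "F = (fact s :: real)^n"
  define P where "P = (\<lambda>\<pi> i j. \<Prod>k<n. pair_kernel s (\<pi> k (D $$ (i, k))) (\<pi> k (D $$ (j, k))))"
  define R where "R = (\<lambda>\<pi> i. \<Prod>k<n. run_kernel s (\<pi> k (D $$ (i, k))))"
  have dims: "dim_row D = N" "dim_col D = n" using D by auto
  have "centered_L2 s (permute_levels \<pi> D)
      = 1 / (real N)^2 * (\<Sum>i<N. \<Sum>j<N. P \<pi> i j) - 2 / real N * (\<Sum>i<N. R \<pi> i) + (13/12)^n" for \<pi>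
    by (simp add: centered_L2_def permute_levels_def Let_def dims P_def R_def
        pair_kernel_def run_kernel_def)
  then have "avg_centered_L2 s D = 1 / F * (\<Sum>\<pi>\<in>L.
      1 / (real N)^2 * (\<Sum>i<N. \<Sum>j<N. P \<pi> i j) - 2 / real N * (\<Sum>i<N. R \<pi> i) + (13/12)^n)"
    by (simp add: avg_centered_L2_def dims L_def F_def)
  also have "\<dots> = 1 / (real N)^2 * ((\<Sum>\<pi>\<in>L. \<Sum>i<N. \<Sum>j<N. P \<pi> i j) / F)
      - 2 / real N * ((\<Sum>\<pi>\<in>L. \<Sum>i<N. R \<pi> i) / F) + real (card L) / F * (13/12)^n"
    by (simp add: sum.distrib sum_subtractf sum_distrib_left[symmetric] sum_divide_distrib[symmetric]
        add_divide_distrib diff_divide_distrib mult.commute)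
  also have "real (card L) / F = 1"
    by (simp add: L_def F_def card_level_perms)
  also have "(\<Sum>\<pi>\<in>L. \<Sum>i<N. \<Sum>j<N. P \<pi> i j) / F = (\<Sum>i<N. \<Sum>j<N. (\<Sum>\<pi>\<in>L. P \<pi> i j) / F)"
    unfolding sum_divide_distrib
    by (subst sum.swap, rule sum.cong[OF refl], rule sum.swap)
  also have "(\<Sum>\<pi>\<in>L. \<Sum>i<N. R \<pi> i) / F = (\<Sum>i<N. (\<Sum>\<pi>\<in>L. R \<pi> i) / F)"
    by (subst sum.swap) (simp add: sum_divide_distrib)
  also have "(\<lambda>i j. (\<Sum>\<pi>\<in>L. P \<pi> i j) / F) = (\<lambda>i j. \<Prod>k<n.
        perm_average s (\<lambda>p. pair_kernel s (p (D $$ (i, k))) (p (D $$ (j, k)))))"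
    unfolding P_def L_def F_def
    by (intro ext average_prod_level_perms[where f = "\<lambda>k p. pair_kernel s (p (D $$ (_, k))) (p (D $$ (_, k)))"])
  also have "(\<lambda>i. (\<Sum>\<pi>\<in>L. R \<pi> i) / F) = (\<lambda>i. \<Prod>k<n.
        perm_average s (\<lambda>p. run_kernel s (p (D $$ (i, k)))))"
    unfolding R_def L_def F_def
    by (intro ext average_prod_level_perms[where f = "\<lambda>k p. run_kernel s (p (D $$ (_, k)))"])
  finally show ?thesis by simp
qed

text \<open>
  Composing with a transposition shows that the sum over all permutations does not depend on the
  level \<open>x\<close>, so it may be averaged over \<open>x\<close>; and for a fixed permutation \<open>p\<close> the sum of \<open>g (p x)\<close>
  over \<open>x\<close> is that of \<open>g\<close>.
\<close>

lemma perm_average_at_level: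
  assumes x: "x < s"
  shows "perm_average s (\<lambda>p. g (p x)) = (\<Sum>y<s. g y) / real s"
proof -
  let ?Q = "{p. p permutes {0..<s}}"
  have indep: "(\<Sum>p\<in>?Q. g (p y)) = (\<Sum>p\<in>?Q. g (p x))" if "y < s" for y
  proof -
    have "Transposition.transpose x y permutes {0..<s}"
      using x that by (intro permutes_swap_id) auto
    from sum_permutations_compose_right[OF this, of "\<lambda>p. g (p x)"]
    show ?thesis by simp
  qed
  have "real s * (\<Sum>p\<in>?Q. g (p x)) = (\<Sum>y\<in>{0..<s}. \<Sum>p\<in>?Q. g (p y))"
    using indep by simp
  also have "\<dots> = (\<Sum>p\<in>?Q. \<Sum>y\<in>{0..<s}. g (p y))"
    by (rule sum.swap)
  also have "\<dots> = (\<Sum>p\<in>?Q. \<Sum>y\<in>{0..<s}. g y)"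
  proof (rule sum.cong[OF refl])
    fix p assume "p \<in> ?Q"
    then show "(\<Sum>y\<in>{0..<s}. g (p y)) = (\<Sum>y\<in>{0..<s}. g y)"
      using sum.permute[of p "{0..<s}" g] by (simp add: o_def)
  qed
  also have "\<dots> = fact s * (\<Sum>y<s. g y)"
    by (simp add: card_permutations lessThan_atLeast0)
  finally show ?thesis
    using x by (simp add: perm_average_def field_simps)
qed

section \<open>Three levels\<close>

lemma perm_average_run_kernel_3:
  assumes "x < 3"
  shows "perm_average 3 (\<lambda>p. run_kernel 3 (p x)) = 29/27"
  unfolding perm_average_at_level[OF assms]
  by (simp add: run_kernel_def scaled_level_def eval_nat_numeral)

text \<open>
  For \<open>x \<noteq> y\<close> a permutation keeps the levels distinct, and the pair kernel is \<open>1\<close> at all pairs of distinct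
  levels: the distance of two of the points \<open>1/6\<close>, \<open>1/2\<close>, \<open>5/6\<close> is the sum of their distances
  from \<open>1/2\<close>.
\<close>

lemma perm_average_pair_kernel_3:
  assumes x: "x < 3" and y: "y < 3"
  shows "perm_average 3 (\<lambda>p. pair_kernel 3 (p x) (p y)) = (if x = y then 11/9 else 1)"
proof (cases "x = y")
  case True
  then show ?thesis
    using perm_average_at_level[OF x, of "\<lambda>z. pair_kernel 3 z z"]
    by (simp add: pair_kernel_def scaled_level_def eval_nat_numeral)
next
  case False
  have distinct: "pair_kernel 3 a b = 1" if "a < 3" "b < 3" "a \<noteq> b" for a b
  proof -
    have "a \<in> {0, 1, 2}" "b \<in> {0, 1, 2}" using that by auto
    with \<open>a \<noteq> b\<close> show ?thesis by (auto simp: pair_kernel_def scaled_level_def)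
  qed
  have "pair_kernel 3 (p x) (p y) = 1" if "p permutes {0..<3}" for p
  proof (rule distinct)
    show "p x < 3" "p y < 3"
      using permutes_in_image[OF that] x y by (metis atLeastLessThan_iff zero_le)+
    show "p x \<noteq> p y" using False permutes_inj[OF that] by (auto dest: injD)
  qed
  then have "(\<Sum>p | p permutes {0..<3}. pair_kernel 3 (p x) (p y)) = (\<Sum>p | p permutes {0..<3::nat}. 1)"
    by (intro sum.cong) auto
  then show ?thesis
    using False by (simp add: perm_average_def card_permutations)
qed

theorem theorem2p2:
  fixes N n :: nat and D :: "nat mat" and \<chi> :: "nat \<Rightarrow> nat \<Rightarrow> complex"
  assumes "design N 3 n D"
    and "orthonormal_contrasts 3 \<chi>"
  shows "avg_centered_L2 3 D =
    (13/12)^n - (29/27)^n + (29/27)^n * (\<Sum>i=1..n. (2/29)^i * word_length_pattern 3 \<chi> D i)"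
proof -
  let ?W = "word_length_pattern 3 \<chi> D"
  have D: "D \<in> carrier_mat N n" and N: "0 < N"
    and lev: "\<And>i k. i < N \<Longrightarrow> k < n \<Longrightarrow> D $$ (i, k) < 3"
    using assms(1) by (auto simp: design_def)
  define S where "S = (\<Sum>i<N. \<Sum>j<N. \<Prod>k<n. if D $$ (i, k) = D $$ (j, k) then 11/9 else (1::real))"
  have pairs: "(\<Sum>i<N. \<Sum>j<N. \<Prod>k<n.
      perm_average 3 (\<lambda>p. pair_kernel 3 (p (D $$ (i, k))) (p (D $$ (j, k))))) = S"
    unfolding S_def by (intro sum.cong prod.cong refl perm_average_pair_kernel_3) (auto intro: lev)
  have runs: "(\<Sum>i<N. \<Prod>k<n. perm_average 3 (\<lambda>p. run_kernel 3 (p (D $$ (i, k)))))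
      = real N * (29/27)^n"
    by (simp add: perm_average_run_kernel_3 lev)
  have avg: "avg_centered_L2 3 D = 1 / (real N)^2 * S - 2 * (29/27)^n + (13/12)^n"
    unfolding avg_centered_L2_eq_kernel_averages[OF D] pairs runs using N by simp
  have "(29/27)^n * (\<Sum>j\<le>n. (2/29)^j * ?W j)
      = 1 / (real N)^2 * (\<Sum>i<N. \<Sum>j<N. (29/27)^n * (\<Prod>k<n.
        if D $$ (i, k) = D $$ (j, k) then 1 + (real 3 - 1) * (2/29) else 1 - 2/29))"
    unfolding word_length_enumerator[OF assms] by (simp add: sum_distrib_left mult.left_commute)
  also have "\<dots> = 1 / (real N)^2 * (\<Sum>i<N. \<Sum>j<N. \<Prod>k<n. 29/27 *
        (if D $$ (i, k) = D $$ (j, k) then 1 + (real 3 - 1) * (2/29) else 1 - 2/29))"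
    unfolding prod.distrib by simp
  also have "\<dots> = 1 / (real N)^2 * S"
    unfolding S_def by (intro arg_cong2[where f = "(*)"] sum.cong prod.cong refl) auto
  finally have "1 / (real N)^2 * S = (29/27)^n * (\<Sum>j\<le>n. (2/29)^j * ?W j)" ..
  moreover have "(\<Sum>j\<le>n. (2/29)^j * ?W j) = 1 + (\<Sum>j=1..n. (2/29)^j * ?W j)"
    using word_length_pattern_0[OF assms] by (simp add: atMost_atLeast0 sum.atLeast_Suc_atMost)
  ultimately show ?thesis
    unfolding avg by (simp add: algebra_simps)
qed

end
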